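(* Let $k=\mathbb F_2$, and let $G=C_2\times C_2=\langle\sigma,\tau\rangle$ act faithfully on $R=k[x,y,z]$ by $$\sigma(x)=x,\quad \sigma(y)=y+x,\quad \sigma(z)=z,\qquad \tau(x)=x,\quad \tau(y)=y,\quad \tau(z)=z+x.$$ Then $R^G=k[x,\,y^2+xy,\,z^2+xz]$ is a polynomial algebra, but $N_G^{\mathrm{full}}(\ell)\in(R^G_+)^2$ for every nonzero linear form $\ell\in R_1$. Hence no full group norm of a linear form occurs in a homogeneous minimal algebra-generating set of $R^G$, and Wehlau's conjecture is false for the full group norm.
   Context: $C_2$ is the cyclic group of order $2$. $R$ is the polynomial ring with its standard grading (all variables in degree $1$), $R_1$ is the $k$-space of linear forms, and $G$ acts by graded $k$-algebra automorphisms. $R^G$ is the graded subring of $G$-invariants, $R^G_+$ is its ideal of positive-degree elements, and $(R^G_+)^2$ is the square of this ideal in $R^G$. For a linear form $\ell$, the full group norm is $N_G^{\mathrm{full}}(\ell)=\prod_{g\in G}g(\ell)$, the product over all group elements (so each orbit element is repeated according to the order of the stabilizer of $\ell$). Wehlau's conjecture on norms (D. L. Wehlau, "Some problems in invariant theory", 2004, and his web page of conjectures) concerns invariant rings of modular representations (characteristic of the field dividing the group order) that are polynomial algebras; as it is used here, and with "norm" read as the full group norm, it predicts that the norm of some linear form occurs in a homogeneous minimal algebra-generating set of the invariant ring. *)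

theory Defs
  imports "HOL-Library.Z2" "HOL-Library.Poly_Mapping" "HOL-Algebra.Algebra"
    "HOL-Algebra.Algebraic_Closure_Type"
begin

section \<open>Polynomial rings with the standard grading\<close>

text \<open>
  A monomial is a finitely supported exponent function \<^typ>\<open>'v \<Rightarrow>\<^sub>0 nat\<close>, a polynomial a finitely
  supported coefficient function on monomials; the ring structure is the convolution product of
  the library.
\<close>

type_synonym ('v, 'k) mpoly = "('v \<Rightarrow>\<^sub>0 nat) \<Rightarrow>\<^sub>0 'k"

definition Const :: "'k \<Rightarrow> ('v, 'k::field) mpoly" where
  "Const c = Poly_Mapping.single 0 c"

definition Var :: "'v \<Rightarrow> ('v, 'k::field) mpoly" where
  "Var v = Poly_Mapping.single (Poly_Mapping.single v 1) 1"

definition mdeg :: "('v \<Rightarrow>\<^sub>0 nat) \<Rightarrow> nat" where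
  "mdeg m = (\<Sum>v\<in>Poly_Mapping.keys m. Poly_Mapping.lookup m v)"

definition graded_piece :: "nat \<Rightarrow> ('v, 'k::field) mpoly set" where
  "graded_piece d = {p. \<forall>m\<in>Poly_Mapping.keys p. mdeg m = d}"

abbreviation linear_forms :: "('v, 'k::field) mpoly set" where
  "linear_forms \<equiv> graded_piece 1"

definition homogeneous :: "('v, 'k::field) mpoly \<Rightarrow> bool" where
  "homogeneous p \<longleftrightarrow> (\<exists>d. p \<in> graded_piece d)"

text \<open>The value of \<open>p\<close> at \<open>a\<close>, i.e. the image of \<open>p\<close> under the \<open>k\<close>-algebra map sending each
  variable \<open>i\<close> to \<open>a i\<close>.\<close>

definition subst :: "('i \<Rightarrow> ('v, 'k::field) mpoly) \<Rightarrow> ('i, 'k) mpoly \<Rightarrow> ('v, 'k) mpoly" where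
  "subst a p = (\<Sum>m\<in>Poly_Mapping.keys p. Const (Poly_Mapping.lookup p m) * (\<Prod>i\<in>Poly_Mapping.keys m. a i ^ Poly_Mapping.lookup m i))"


section \<open>Subalgebras and generators\<close>

definition subalgebra :: "('v, 'k::field) mpoly set \<Rightarrow> bool" where
  "subalgebra A \<longleftrightarrow> range Const \<subseteq> A \<and> (\<forall>p\<in>A. \<forall>q\<in>A. p + q \<in> A \<and> p * q \<in> A)"

definition generated_algebra :: "('v, 'k::field) mpoly set \<Rightarrow> ('v, 'k) mpoly set" where
  "generated_algebra S = subalgebra hull S"

text \<open>The elements of \<open>S\<close> themselves serve as the variables of a potential algebraic relation.\<close>

definition algebraically_independent :: "('v, 'k::field) mpoly set \<Rightarrow> bool" where
  "algebraically_independent S \<longleftrightarrow>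
     (\<forall>p :: (('v, 'k) mpoly, 'k) mpoly.
        (\<forall>m\<in>Poly_Mapping.keys p. Poly_Mapping.keys m \<subseteq> S) \<and> subst (\<lambda>s. s) p = 0 \<longrightarrow> p = 0)"

definition polynomial_algebra :: "('v, 'k::field) mpoly set \<Rightarrow> bool" where
  "polynomial_algebra A \<longleftrightarrow> (\<exists>S. algebraically_independent S \<and> A = generated_algebra S)"

definition homogeneous_minimal_generating_set ::
    "('v, 'k::field) mpoly set \<Rightarrow> ('v, 'k) mpoly set \<Rightarrow> bool" where
  "homogeneous_minimal_generating_set A S \<longleftrightarrow>
     (\<forall>s\<in>S. homogeneous s) \<and> generated_algebra S = A \<and>
     (\<forall>T. T \<subset> S \<longrightarrow> generated_algebra T \<noteq> A)"


section \<open>Graded group actions, invariants and norms\<close>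

definition graded_algebra_automorphism ::
    "(('v, 'k::field) mpoly \<Rightarrow> ('v, 'k) mpoly) \<Rightarrow> bool" where
  "graded_algebra_automorphism f \<longleftrightarrow>
     bij f \<and> (\<forall>c. f (Const c) = Const c) \<and>
     (\<forall>p q. f (p + q) = f p + f q) \<and> (\<forall>p q. f (p * q) = f p * f q) \<and>
     (\<forall>d. f ` graded_piece d = graded_piece d)"

definition graded_action ::
    "('g, 'm) monoid_scheme \<Rightarrow> ('g \<Rightarrow> ('v, 'k::field) mpoly \<Rightarrow> ('v, 'k) mpoly) \<Rightarrow> bool" where
  "graded_action G \<phi> \<longleftrightarrow>
     group_action G UNIV \<phi> \<and> (\<forall>g\<in>carrier G. graded_algebra_automorphism (\<phi> g))"

definition invariant_ring ::
    "('g, 'm) monoid_scheme \<Rightarrow> ('g \<Rightarrow> ('v, 'k::field) mpoly \<Rightarrow> ('v, 'k) mpoly)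
      \<Rightarrow> ('v, 'k) mpoly ring" where
  "invariant_ring G \<phi> = ring_of_type_algebra \<lparr>carrier := {p. \<forall>g\<in>carrier G. \<phi> g p = p}\<rparr>"

text \<open>The ideal \<open>R\<^sup>G\<^sub>+\<close>: an invariant is a sum of homogeneous components of positive degree iff its
  constant term vanishes.\<close>

definition invariant_ideal ::
    "('g, 'm) monoid_scheme \<Rightarrow> ('g \<Rightarrow> ('v, 'k::field) mpoly \<Rightarrow> ('v, 'k) mpoly)
      \<Rightarrow> ('v, 'k) mpoly set" where
  "invariant_ideal G \<phi> = {p \<in> carrier (invariant_ring G \<phi>). Poly_Mapping.lookup p 0 = 0}"

definition invariant_ideal_square ::
    "('g, 'm) monoid_scheme \<Rightarrow> ('g \<Rightarrow> ('v, 'k::field) mpoly \<Rightarrow> ('v, 'k) mpoly)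
      \<Rightarrow> ('v, 'k) mpoly set" where
  "invariant_ideal_square G \<phi> =
     ideal_prod (invariant_ring G \<phi>) (invariant_ideal G \<phi>) (invariant_ideal G \<phi>)"

definition full_norm ::
    "('g, 'm) monoid_scheme \<Rightarrow> ('g \<Rightarrow> ('v, 'k::field) mpoly \<Rightarrow> ('v, 'k) mpoly)
      \<Rightarrow> ('v, 'k) mpoly \<Rightarrow> ('v, 'k) mpoly" where
  "full_norm G \<phi> l = (\<Prod>g\<in>carrier G. \<phi> g l)"


section \<open>Wehlau's conjecture for the full group norm\<close>

text \<open>
  The assertion of the conjecture for all faithful modular representations over \<open>'k\<close> of finite
  groups with elements in \<open>'g\<close>, on the span of the variables \<open>'v\<close>. The conjecture proper is this
  assertion for all types \<open>'k\<close>, \<open>'v\<close>, \<open>'g\<close>, hence is refuted by a single instance. Without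
  faithfulness it would fail trivially, since the full norm would then be a proper power.
\<close>

definition wehlau_conjecture_full_norm ::
    "'k::field itself \<Rightarrow> 'v::finite itself \<Rightarrow> 'g itself \<Rightarrow> bool" where
  "wehlau_conjecture_full_norm _ _ _ \<longleftrightarrow>
     (\<forall>(G :: 'g monoid) (\<phi> :: 'g \<Rightarrow> ('v, 'k) mpoly \<Rightarrow> ('v, 'k) mpoly).
        finite (carrier G) \<and> graded_action G \<phi> \<and> faithful_action G UNIV \<phi> \<and>
        CHAR('k) dvd Coset.order G \<and> polynomial_algebra (carrier (invariant_ring G \<phi>)) \<longrightarrow>
        (\<exists>l\<in>linear_forms. \<exists>S.
           homogeneous_minimal_generating_set (carrier (invariant_ring G \<phi>)) S \<and>
           full_norm G \<phi> l \<in> S))"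


section \<open>The action of \<open>C\<^sub>2 \<times> C\<^sub>2\<close> on \<open>\<bbbF>\<^sub>2[x, y, z]\<close>\<close>

datatype var = VX | VY | VZ

instance var :: finite
proof
  have "(UNIV :: var set) = {VX, VY, VZ}"
    using var.exhaust by blast
  then show "finite (UNIV :: var set)"
    by (metis finite.emptyI finite.insertI)
qed

abbreviation x :: "(var, bit) mpoly" where "x \<equiv> Var VX"
abbreviation y :: "(var, bit) mpoly" where "y \<equiv> Var VY"
abbreviation z :: "(var, bit) mpoly" where "z \<equiv> Var VZ"

definition V4 :: "(int \<times> int) monoid" where
  "V4 = integer_mod_group 2 \<times>\<times> integer_mod_group 2"

definition \<sigma> :: "int \<times> int" where "\<sigma> = (1, 0)"
definition \<tau> :: "int \<times> int" where "\<tau> = (0, 1)"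

definition act :: "int \<times> int \<Rightarrow> (var, bit) mpoly \<Rightarrow> (var, bit) mpoly" where
  "act g = subst (case_var x (y + of_int (fst g) * x) (z + of_int (snd g) * x))"

end

theory Submission
  imports Defs
begin

text \<open>
  Put \<open>u = y\<^sup>2 + xy\<close> and \<open>v = z\<^sup>2 + xz\<close>. Every polynomial is \<open>p = a + by + cz + dyz\<close> with
  \<open>a, b, c, d \<in> k[x, u, v]\<close>, and \<open>\<sigma>(p) - p = x(b + dz)\<close>; cancelling \<open>x\<close>, and likewise for \<open>\<tau>\<close>,
  invariance forces \<open>b = c = d = 0\<close>. The generators are independent because
  \<open>x\<^sup>i u\<^sup>j v\<^sup>k \<equiv> x\<^sup>i y\<^sup>2\<^sup>j z\<^sup>2\<^sup>k\<close> modulo \<open>x\<^sup>i\<^sup>+\<^sup>1\<close>. The orbit of a linear form \<open>l\<close> is contained in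
  \<open>{l, l + x}\<close>, so its full norm is the square of a quadratic invariant, and a product of invariants
  of positive degree is redundant in every homogeneous generating set.
\<close>

section \<open>Polynomials\<close>

lemma mpoly_sum_monomials:
  fixes p :: "'a \<Rightarrow>\<^sub>0 'b::comm_monoid_add"
  shows "p = (\<Sum>m\<in>Poly_Mapping.keys p. Poly_Mapping.single m (Poly_Mapping.lookup p m))"
proof (rule poly_mapping_eqI)
  fix n
  have "(\<Sum>m\<in>Poly_Mapping.keys p. Poly_Mapping.lookup (Poly_Mapping.single m (Poly_Mapping.lookup p m)) n)
      = (\<Sum>m\<in>Poly_Mapping.keys p. if m = n then Poly_Mapping.lookup p n else 0)"
    by (rule sum.cong) (auto simp: lookup_single when_def)
  then show "Poly_Mapping.lookup p n = Poly_Mapping.lookup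
      (\<Sum>m\<in>Poly_Mapping.keys p. Poly_Mapping.single m (Poly_Mapping.lookup p m)) n"
    by (auto simp: lookup_sum in_keys_iff)
qed

text \<open>The types are kept general so that the rule serves both polynomials and the exponent
  functions that are their monomials.\<close>

lemma mpoly_induct [case_names zero monomial add]:
  fixes p :: "'a \<Rightarrow>\<^sub>0 'b::comm_monoid_add"
  assumes "P 0" and "\<And>m c. P (Poly_Mapping.single m c)" and "\<And>p q. P p \<Longrightarrow> P q \<Longrightarrow> P (p + q)"
  shows "P p"
proof -
  have "P (\<Sum>m\<in>I. Poly_Mapping.single m (Poly_Mapping.lookup p m))" if "finite I" for I
    using that by (induction I rule: finite_induct) (auto intro: assms)
  then show ?thesis
    using mpoly_sum_monomials[of p] by (metis finite_keys)
qed

lemma Const_add: "Const (c + d) = Const c + Const d"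
  by (simp add: Const_def single_add)

lemma Const_mult: "Const (c * d) = Const c * Const d"
  by (simp add: Const_def mult_single)

lemma Const_0 [simp]: "Const 0 = 0"
  by (simp add: Const_def)

lemma Const_1 [simp]: "Const 1 = 1"
  by (simp add: Const_def)

lemma Const_of_int: "Const (of_int n) = of_int n"
  by (simp add: Const_def)

lemma Const_mult_monomial: "Const c * Poly_Mapping.single m 1 = Poly_Mapping.single m c"
  by (simp add: Const_def mult_single)

lemma lookup_Const_mult: "Poly_Mapping.lookup (Const c * p) m = c * Poly_Mapping.lookup p m"
  by (simp add: Const_def lookup_mult lookup_single when_mult)

lemma Var_power: "Var v ^ n = Poly_Mapping.single (Poly_Mapping.single v n) 1"
  by (induction n) (simp_all add: Var_def mult_single flip: single_add)

lemma lookup_monomial_mult: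
  fixes p :: "('v, 'k::field) mpoly"
  shows "Poly_Mapping.lookup (Poly_Mapping.single m 1 * p) (m + n) = Poly_Mapping.lookup p n"
  by (simp add: lookup_mult lookup_single when_mult)

text \<open>Multiplication by a variable shifts exponents without merging coefficients. This is the
  cancellation of \<open>x\<close> in the computation of the invariants.\<close>

lemma Var_mult_eq_0_iff: "Var v * p = 0 \<longleftrightarrow> p = 0"
proof
  assume "Var v * p = 0"
  then have "Poly_Mapping.lookup p n = 0" for n
    using lookup_monomial_mult[of "Poly_Mapping.single v 1" p n] by (simp add: Var_def)
  then show "p = 0"
    by (simp add: poly_mapping_eqI)
qed simp

lemma prod_keys_superset:
  assumes "finite I" and "Poly_Mapping.keys m \<subseteq> I"
  shows "(\<Prod>i\<in>Poly_Mapping.keys m. a i ^ Poly_Mapping.lookup m i) = (\<Prod>i\<in>I. a i ^ Poly_Mapping.lookup m i)"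
  using assms by (intro prod.mono_neutral_left) (auto simp: in_keys_iff)

lemma prod_keys_add:
  fixes a :: "'i \<Rightarrow> 'a::comm_semiring_1"
  shows "(\<Prod>i\<in>Poly_Mapping.keys (m + n). a i ^ Poly_Mapping.lookup (m + n) i) =
    (\<Prod>i\<in>Poly_Mapping.keys m. a i ^ Poly_Mapping.lookup m i) *
    (\<Prod>i\<in>Poly_Mapping.keys n. a i ^ Poly_Mapping.lookup n i)"
proof -
  let ?I = "Poly_Mapping.keys m \<union> Poly_Mapping.keys n"
  show ?thesis
    using prod_keys_superset[OF _ keys_add[of m n], of a]
    by (simp add: prod_keys_superset[of ?I m] prod_keys_superset[of ?I n]
      lookup_add power_add prod.distrib)
qed


section \<open>Substitution is an algebra homomorphism\<close>

text \<open>Coefficients vanish off the support, so \<open>p\<close>, \<open>q\<close> and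
  \<open>p + q\<close> can be expanded over one common index set.\<close>

lemma subst_superset:
  assumes "finite I" and "Poly_Mapping.keys p \<subseteq> I"
  shows "subst a p = (\<Sum>m\<in>I. Const (Poly_Mapping.lookup p m) *
    (\<Prod>i\<in>Poly_Mapping.keys m. a i ^ Poly_Mapping.lookup m i))"
  unfolding subst_def using assms by (intro sum.mono_neutral_left) (auto simp: in_keys_iff)

lemma subst_monomial: "subst a (Poly_Mapping.single m c) =
    Const c * (\<Prod>i\<in>Poly_Mapping.keys m. a i ^ Poly_Mapping.lookup m i)"
  by (subst subst_superset[of "{m}"]) auto

lemma subst_0 [simp]: "subst a 0 = 0"
  by (simp add: subst_def)

lemma subst_add: "subst a (p + q) = subst a p + subst a q"
proof -
  let ?I = "Poly_Mapping.keys p \<union> Poly_Mapping.keys q"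
  show ?thesis
    using keys_add[of p q]
    by (simp add: subst_superset[of ?I] lookup_add Const_add distrib_right sum.distrib)
qed

lemma subst_mult: "subst a (p * q) = subst a p * subst a q"
proof (induction p rule: mpoly_induct)
  case (monomial m c)
  show ?case
  proof (induction q rule: mpoly_induct)
    case (monomial n d)
    show ?case
      by (simp add: mult_single subst_monomial prod_keys_add Const_mult algebra_simps)
  qed (simp_all add: distrib_left subst_add)
qed (simp_all add: distrib_right subst_add)

lemma subst_Const [simp]: "subst a (Const c) = Const c"
  unfolding Const_def by (subst subst_monomial) (simp add: Const_def)

lemma subst_Var [simp]: "subst a (Var v) = a v"
  by (simp add: Var_def subst_monomial)

lemma subst_1 [simp]: "subst a 1 = 1"
  by (metis Const_1 subst_Const)

lemma subst_of_int [simp]: "subst a (of_int n) = of_int n"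
  by (metis Const_of_int subst_Const)

lemma subst_power: "subst a (p ^ n) = subst a p ^ n"
  by (induction n) (simp_all add: subst_mult)

text \<open>Constants and variables generate the polynomial ring. Hence algebra maps that agree on
  the variables agree everywhere, which is how composed substitutions are compared.\<close>

lemma mpoly_algebra_induct [case_names Const Var add mult]:
  assumes "\<And>c. P (Const c)" and "\<And>v. P (Var v)"
    and "\<And>p q. P p \<Longrightarrow> P q \<Longrightarrow> P (p + q)" and "\<And>p q. P p \<Longrightarrow> P q \<Longrightarrow> P (p * q)"
  shows "P p"
proof (induction p rule: mpoly_induct)
  case zero
  show ?case
    using assms(1)[of 0] by simp
next
  case (monomial m c)
  have "P (Poly_Mapping.single m 1)"
  \<comment> \<open>The exponent function is itself finitely supported, so additive induction builds
    it from the exponents of powers of one variable.\<close>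
  proof (induction m rule: mpoly_induct)
    case zero
    then show ?case using assms(1)[of 1] by simp
  next
    case (monomial v n)
    have "P (Var v ^ n)"
    proof (induction n)
      case 0
      then show ?case using assms(1)[of 1] by simp
    qed (simp add: assms)
    then show ?case by (simp add: Var_power)
  next
    case (add m n)
    then have "P (Poly_Mapping.single m 1 * Poly_Mapping.single n 1)"
      by (rule assms(4))
    then show ?case by (simp add: mult_single)
  qed
  then show ?case
    using assms(1,4) by (metis Const_mult_monomial)
qed (rule assms(3))

lemma subst_subst: "subst a (subst b p) = subst (\<lambda>i. subst a (b i)) p"
  by (induction p rule: mpoly_algebra_induct) (simp_all add: subst_add subst_mult)

lemma subst_Var_ident [simp]: "subst Var p = p"
  by (induction p rule: mpoly_algebra_induct) (simp_all add: subst_add subst_mult)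


section \<open>The grading\<close>

lemma mdeg_superset:
  assumes "finite I" and "Poly_Mapping.keys m \<subseteq> I"
  shows "mdeg m = (\<Sum>v\<in>I. Poly_Mapping.lookup m v)"
  unfolding mdeg_def using assms by (intro sum.mono_neutral_left) (auto simp: in_keys_iff)

lemma mdeg_0 [simp]: "mdeg 0 = 0"
  by (simp add: mdeg_def)

lemma mdeg_single [simp]: "mdeg (Poly_Mapping.single v n) = n"
  by (subst mdeg_superset[of "{v}"]) auto

lemma mdeg_add: "mdeg (m + n) = mdeg m + mdeg n"
proof -
  let ?I = "Poly_Mapping.keys m \<union> Poly_Mapping.keys n"
  show ?thesis
    using keys_add[of m n] by (simp add: mdeg_superset[of ?I] lookup_add sum.distrib)
qed

lemma mdeg_eq_1:
  assumes "mdeg m = 1"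
  obtains v where "m = Poly_Mapping.single v 1"
proof -
  obtain v where v: "v \<in> Poly_Mapping.keys m" "Poly_Mapping.lookup m v = 1"
      "\<And>w. w \<in> Poly_Mapping.keys m \<Longrightarrow> w \<noteq> v \<Longrightarrow> Poly_Mapping.lookup m w = 0"
    using assms sum_eq_1_iff[of "Poly_Mapping.keys m" "Poly_Mapping.lookup m"]
    unfolding mdeg_def by auto
  have "m = Poly_Mapping.single v 1"
    using v by (intro poly_mapping_eqI) (auto simp: lookup_single when_def in_keys_iff)
  then show thesis ..
qed

lemma graded_piece_0 [simp]: "0 \<in> graded_piece d"
  by (simp add: graded_piece_def)

lemma graded_piece_add: "p \<in> graded_piece d \<Longrightarrow> q \<in> graded_piece d \<Longrightarrow> p + q \<in> graded_piece d"
  using keys_add[of p q] by (auto simp: graded_piece_def)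

lemma graded_piece_sum: "(\<And>i. i \<in> I \<Longrightarrow> f i \<in> graded_piece d) \<Longrightarrow> sum f I \<in> graded_piece d"
  by (induction I rule: infinite_finite_induct) (auto intro: graded_piece_add)

lemma graded_piece_mult:
  "p \<in> graded_piece d \<Longrightarrow> q \<in> graded_piece e \<Longrightarrow> p * q \<in> graded_piece (d + e)"
  using keys_mult[of p q] by (fastforce simp: graded_piece_def mdeg_add)

lemma graded_piece_Const: "Const c \<in> graded_piece 0"
  by (simp add: graded_piece_def Const_def)

lemma graded_piece_of_int: "of_int n \<in> graded_piece 0"
  using graded_piece_Const[of "of_int n"] by (simp add: Const_of_int)

lemma graded_piece_Var: "Var v \<in> linear_forms"
  by (simp add: graded_piece_def Var_def)

lemma graded_piece_power: "p \<in> graded_piece d \<Longrightarrow> p ^ n \<in> graded_piece (n * d)"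
proof (induction n)
  case 0
  then show ?case using graded_piece_Const[of 1] by simp
qed (auto dest: graded_piece_mult)

lemma graded_piece_prod:
  "(\<And>i. i \<in> I \<Longrightarrow> f i \<in> graded_piece (d i)) \<Longrightarrow> prod f I \<in> graded_piece (sum d I)"
proof (induction I rule: infinite_finite_induct)
  case (insert i I)
  then show ?case by (auto intro!: graded_piece_mult)
qed (use graded_piece_Const[of 1] in simp_all)

lemma subst_graded_piece:
  assumes "\<And>i. a i \<in> linear_forms" and "p \<in> graded_piece d"
  shows "subst a p \<in> graded_piece d"
  unfolding subst_def
proof (rule graded_piece_sum)
  fix m assume "m \<in> Poly_Mapping.keys p"
  with assms(2) have "mdeg m = d"
    by (simp add: graded_piece_def)
  moreover have "(\<Prod>i\<in>Poly_Mapping.keys m. a i ^ Poly_Mapping.lookup m i) \<in> graded_piece (mdeg m)"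
    unfolding mdeg_def using graded_piece_power[OF assms(1)] by (intro graded_piece_prod) simp
  ultimately show "Const (Poly_Mapping.lookup p m) *
      (\<Prod>i\<in>Poly_Mapping.keys m. a i ^ Poly_Mapping.lookup m i) \<in> graded_piece d"
    using graded_piece_mult[OF graded_piece_Const] by fastforce
qed

lemma linear_form_expansion:
  fixes l :: "('v::finite, 'k::field) mpoly"
  assumes "l \<in> linear_forms"
  shows "l = (\<Sum>v\<in>UNIV. Const (Poly_Mapping.lookup l (Poly_Mapping.single v 1)) * Var v)"
proof (rule poly_mapping_eqI)
  fix m
  let ?c = "\<lambda>v. Poly_Mapping.lookup l (Poly_Mapping.single v 1)"
  have "Poly_Mapping.lookup (\<Sum>v\<in>UNIV. Const (?c v) * Var v) m
      = (\<Sum>v\<in>UNIV. if m = Poly_Mapping.single v 1 then ?c v else 0)"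
    unfolding lookup_sum Var_def Const_mult_monomial
    by (rule sum.cong) (auto simp: lookup_single when_def)
  also have "\<dots> = Poly_Mapping.lookup l m"
  proof (cases "mdeg m = 1")
    case True
    then obtain w where "m = Poly_Mapping.single w 1"
      by (rule mdeg_eq_1)
    moreover have "Poly_Mapping.single w (1::nat) = Poly_Mapping.single v 1 \<longleftrightarrow> w = v" for v
      by (metis keys_single singleton_iff zero_neq_one)
    ultimately show ?thesis by simp
  next
    case False
    then have "m \<noteq> Poly_Mapping.single v 1" for v
      by auto
    with False assms show ?thesis
      by (auto simp: graded_piece_def in_keys_iff)
  qed
  finally show "Poly_Mapping.lookup l m = Poly_Mapping.lookup (\<Sum>v\<in>UNIV. Const (?c v) * Var v) m" ..
qed

section \<open>Homogeneous components\<close>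

definition hcomp :: "nat \<Rightarrow> ('v, 'k::field) mpoly \<Rightarrow> ('v, 'k) mpoly" where
  "hcomp d p = Poly_Mapping.mapp (\<lambda>m c. c when mdeg m = d) p"

lemma lookup_hcomp: "Poly_Mapping.lookup (hcomp d p) m = (Poly_Mapping.lookup p m when mdeg m = d)"
  by (auto simp: hcomp_def lookup_mapp when_def in_keys_iff)

lemma hcomp_graded_piece: "hcomp d p \<in> graded_piece d"
  by (auto simp: graded_piece_def in_keys_iff lookup_hcomp when_def split: if_splits)

lemma hcomp_add: "hcomp d (p + q) = hcomp d p + hcomp d q"
  by (rule poly_mapping_eqI) (simp add: lookup_hcomp lookup_add when_def)

lemma hcomp_0 [simp]: "hcomp d 0 = 0"
  by (rule poly_mapping_eqI) (simp add: lookup_hcomp)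

lemma hcomp_sum: "hcomp d (sum f I) = (\<Sum>i\<in>I. hcomp d (f i))"
  by (induction I rule: infinite_finite_induct) (simp_all add: hcomp_add)

lemma hcomp_of_graded_piece: "p \<in> graded_piece e \<Longrightarrow> hcomp d p = (if d = e then p else 0)"
  by (rule poly_mapping_eqI) (auto simp: lookup_hcomp graded_piece_def in_keys_iff when_def)

lemma sum_hcomp: "p = (\<Sum>d\<in>mdeg ` Poly_Mapping.keys p. hcomp d p)"
  by (rule poly_mapping_eqI) (auto simp: lookup_sum lookup_hcomp when_def in_keys_iff)

text \<open>After both factors are expanded, each \<open>hcomp i p * hcomp j q\<close> is
  homogeneous of degree \<open>i + j\<close>, so the projection either keeps or kills it.\<close>

lemma hcomp_mult:
  "hcomp d (p * q) = (\<Sum>i\<in>mdeg ` Poly_Mapping.keys p. \<Sum>j\<in>mdeg ` Poly_Mapping.keys q.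
     if d = i + j then hcomp i p * hcomp j q else 0)"
proof -
  have "p * q = (\<Sum>i\<in>mdeg ` Poly_Mapping.keys p. \<Sum>j\<in>mdeg ` Poly_Mapping.keys q. hcomp i p * hcomp j q)"
    using sum_hcomp[of p] sum_hcomp[of q] by (metis sum_product)
  then show ?thesis
    by (simp add: hcomp_sum hcomp_of_graded_piece[OF graded_piece_mult[OF hcomp_graded_piece hcomp_graded_piece]])
qed


section \<open>Subalgebras and minimal generating sets\<close>

lemma subalgebra_generated_algebra: "subalgebra (generated_algebra S)"
  unfolding generated_algebra_def by (rule hull_in) (auto simp: subalgebra_def)

lemma generated_algebra_superset: "S \<subseteq> generated_algebra S"
  unfolding generated_algebra_def by (rule hull_subset)

lemma generated_algebra_minimal: "S \<subseteq> A \<Longrightarrow> subalgebra A \<Longrightarrow> generated_algebra S \<subseteq> A"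
  unfolding generated_algebra_def by (rule hull_minimal)

context
  fixes A :: "('v, 'k::field) mpoly set"
  assumes A: "subalgebra A"
begin

lemma subalgebra_Const: "Const c \<in> A"
  using A by (auto simp: subalgebra_def)

lemma subalgebra_add: "p \<in> A \<Longrightarrow> q \<in> A \<Longrightarrow> p + q \<in> A"
  using A by (simp add: subalgebra_def)

lemma subalgebra_mult: "p \<in> A \<Longrightarrow> q \<in> A \<Longrightarrow> p * q \<in> A"
  using A by (simp add: subalgebra_def)

lemma subalgebra_0: "0 \<in> A"
  using subalgebra_Const[of 0] by simp

lemma subalgebra_sum: "(\<And>i. i \<in> I \<Longrightarrow> f i \<in> A) \<Longrightarrow> sum f I \<in> A"
  by (induction I rule: infinite_finite_induct) (auto intro: subalgebra_0 subalgebra_add)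

end

text \<open>Components of degree below \<open>e\<close> do not see a generator of degree \<open>e\<close>.\<close>

lemma generated_algebra_remove_generator:
  assumes hom: "\<And>t. t \<in> S \<Longrightarrow> homogeneous t"
    and s: "s \<in> graded_piece e"
    and f: "f \<in> generated_algebra S" "f \<in> graded_piece d" and de: "d < e"
  shows "f \<in> generated_algebra (S - {s})"
proof -
  let ?T = "generated_algebra (S - {s})"
  note alg = subalgebra_generated_algebra[of "S - {s}"]
  \<comment> \<open>\<open>?B\<close> collects the polynomials whose components below degree
    \<open>e\<close> are already generated without \<open>s\<close>. It is a subalgebra containing
    \<open>S\<close>, hence contains \<open>f\<close>.\<close>
  let ?B = "{p. \<forall>d<e. hcomp d p \<in> ?T}"
  have "hcomp d (Const c) \<in> ?T" for d c
    by (auto simp: hcomp_of_graded_piece[OF graded_piece_Const] intro: subalgebra_0[OF alg] subalgebra_Const[OF alg])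
  \<comment> \<open>A component of degree \<open>d < e\<close> of a product only involves pairs with
    \<open>i + j = d\<close>, so both \<open>i\<close> and \<open>j\<close> are below
    \<open>e\<close>.\<close>
  moreover have "p * q \<in> ?B" if "p \<in> ?B" "q \<in> ?B" for p q
    using that unfolding hcomp_mult mem_Collect_eq
    by (auto intro!: subalgebra_sum[OF alg] subalgebra_mult[OF alg] subalgebra_0[OF alg])
  ultimately have B: "subalgebra ?B"
    by (auto simp: subalgebra_def hcomp_add intro: subalgebra_add[OF alg])
  have "t \<in> ?B" if t: "t \<in> S" for t
  proof (cases "t = s")
    \<comment> \<open>\<open>s\<close> is concentrated in degree \<open>e\<close>, so its components
      below \<open>e\<close> are zero.\<close>
    case True
    then show ?thesis
      using subalgebra_0[OF alg] by (auto simp: hcomp_of_graded_piece[OF s])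
  next
    case False
    then have "t \<in> ?T"
      using t by (intro subsetD[OF generated_algebra_superset]) simp
    moreover from hom[OF t] obtain d where d: "t \<in> graded_piece d"
      by (auto simp: homogeneous_def)
    ultimately show ?thesis
      using subalgebra_0[OF alg] by (auto simp: hcomp_of_graded_piece[OF d])
  qed
  then have "S \<subseteq> ?B"
    by (rule subsetI)
  then have "generated_algebra S \<subseteq> ?B"
    using B by (rule generated_algebra_minimal)
  with f(1) have "f \<in> ?B"
    by (rule rev_subsetD)
  then show ?thesis
    using de by (auto simp: hcomp_of_graded_piece[OF f(2)])
qed

text \<open>If \<open>s\<close> were generated by the rest, the proper subset \<open>S - {s}\<close>
  would still generate \<open>A\<close>, against minimality.\<close>

lemma homogeneous_minimal_generating_set_irredundant:
  assumes "homogeneous_minimal_generating_set A S" and "s \<in> S"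
  shows "s \<notin> generated_algebra (S - {s})"
proof
  assume "s \<in> generated_algebra (S - {s})"
  then have "generated_algebra (insert s (S - {s})) = generated_algebra (S - {s})"
    unfolding generated_algebra_def by (rule hull_redundant)
  with assms show False
    by (auto simp: homogeneous_minimal_generating_set_def insert_absorb)
qed

text \<open>Positivity makes both degrees strictly smaller than \<open>d + e\<close>, so the factors
  stay generated after \<open>f * g\<close> is removed, and then so does their product.\<close>

lemma product_notin_homogeneous_minimal_generating_set:
  assumes S: "homogeneous_minimal_generating_set A S"
    and f: "f \<in> A" "f \<in> graded_piece d" "d > 0" and g: "g \<in> A" "g \<in> graded_piece e" "e > 0"
  shows "f * g \<notin> S"
proof
  assume "f * g \<in> S"
  let ?T = "generated_algebra (S - {f * g})"
  have gen: "generated_algebra S = A" and hom: "\<And>t. t \<in> S \<Longrightarrow> homogeneous t"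
    using S by (auto simp: homogeneous_minimal_generating_set_def)
  have "f * g \<in> graded_piece (d + e)"
    using f g by (intro graded_piece_mult)
  then have "f \<in> ?T" "g \<in> ?T"
    using generated_algebra_remove_generator[OF hom] f g gen by auto
  then have "f * g \<in> ?T"
    by (rule subalgebra_mult[OF subalgebra_generated_algebra])
  with homogeneous_minimal_generating_set_irredundant[OF S \<open>f * g \<in> S\<close>] show False ..
qed


section \<open>The action of the Klein four-group\<close>

text \<open>Since \<open>u = y * (y + x)\<close> and \<open>v = z * (z + x)\<close>, these are the
  orbit products of \<open>y\<close> and \<open>z\<close>.\<close>

abbreviation (input) u :: "(var, bit) mpoly" where "u \<equiv> y\<^sup>2 + x * y"
abbreviation (input) v :: "(var, bit) mpoly" where "v \<equiv> z\<^sup>2 + x * z"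

lemma mpoly_bit_2 [simp]: "(2 :: ('v, bit) mpoly) = 0"
  by (metis Const_0 Const_of_int bit_2_eq_0 of_int_numeral)

lemma mpoly_bit_add_self [simp]: "p + p = 0" for p :: "('v, bit) mpoly"
  by (metis mpoly_bit_2 mult_2 mult_zero_left)

text \<open>Combined with associativity and commutativity, this cancels equal summands inside longer
  sums.\<close>

lemma mpoly_bit_add_self_left [simp]: "p + (p + q) = q" for p q :: "('v, bit) mpoly"
  by (metis mpoly_bit_add_self add.assoc add_0)

text \<open>Group elements are pairs of residues added modulo 2, while the action embeds them by
  \<open>of_int\<close>; characteristic two reconciles the two.\<close>

lemma of_int_mod_2: "(of_int (n mod 2) :: ('v, bit) mpoly) = of_int n"
proof -
  have "(of_int n :: ('v, bit) mpoly) = of_int (2 * (n div 2) + n mod 2)"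
    by simp
  also have "\<dots> = of_int (n mod 2)"
    unfolding of_int_add of_int_mult by simp
  finally show ?thesis ..
qed

lemma carrier_V4: "carrier V4 = {(0, 0), (0, 1), (1, 0), (1, 1)}"
proof -
  have "{0..<2} = {0, 1 :: int}"
    by auto
  then show ?thesis
    by (auto simp: V4_def carrier_integer_mod_group)
qed

lemma mult_V4: "(a, b) \<otimes>\<^bsub>V4\<^esub> (c, d) = ((a + c) mod 2, (b + d) mod 2)"
  by (simp add: V4_def)

lemma one_V4: "\<one>\<^bsub>V4\<^esub> = (0, 0)"
  by (simp add: V4_def)

lemma group_V4: "group V4"
  by (simp add: V4_def DirProd_group)

lemma generate_V4: "generate V4 {\<sigma>, \<tau>} = carrier V4"
proof
  show "generate V4 {\<sigma>, \<tau>} \<subseteq> carrier V4"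
    using group_V4 by (intro group.generate_incl) (auto simp: carrier_V4 \<sigma>_def \<tau>_def)
  have st: "\<sigma> \<in> generate V4 {\<sigma>, \<tau>}" "\<tau> \<in> generate V4 {\<sigma>, \<tau>}"
    by (auto intro: generate.incl)
  moreover have "\<one>\<^bsub>V4\<^esub> \<in> generate V4 {\<sigma>, \<tau>}"
    by (rule generate.one)
  moreover have "\<sigma> \<otimes>\<^bsub>V4\<^esub> \<tau> \<in> generate V4 {\<sigma>, \<tau>}"
    using st by (rule generate.eng)
  ultimately show "carrier V4 \<subseteq> generate V4 {\<sigma>, \<tau>}"
    by (simp add: carrier_V4 one_V4 \<sigma>_def \<tau>_def mult_V4)
qed

lemma act_Const [simp]: "act g (Const c) = Const c"
  by (simp add: act_def)

lemma act_0 [simp]: "act g 0 = 0"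
  by (simp add: act_def)

lemma act_x [simp]: "act g x = x"
  by (simp add: act_def)

lemma act_y: "act g y = y + of_int (fst g) * x"
  by (simp add: act_def)

lemma act_z: "act g z = z + of_int (snd g) * x"
  by (simp add: act_def)

lemma act_add: "act g (p + q) = act g p + act g q"
  by (simp add: act_def subst_add)

lemma act_mult: "act g (p * q) = act g p * act g q"
  by (simp add: act_def subst_mult)

lemma act_power: "act g (p ^ n) = act g p ^ n"
  by (simp add: act_def subst_power)

text \<open>Both sides are substitutions, so the variables decide. The shifts of \<open>y\<close>
  and \<open>z\<close> are multiples of the fixed \<open>x\<close> and therefore add.\<close>

lemma act_act: "act g (act h p) = act (g \<otimes>\<^bsub>V4\<^esub> h) p"
proof (cases g, cases h)
  fix a b c d assume gh: "g = (a, b)" "h = (c, d)"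
  have "act g (case w of VX \<Rightarrow> x | VY \<Rightarrow> y + of_int c * x | VZ \<Rightarrow> z + of_int d * x) =
      (case w of VX \<Rightarrow> x | VY \<Rightarrow> y + of_int ((a + c) mod 2) * x | VZ \<Rightarrow> z + of_int ((b + d) mod 2) * x)" for w
    by (cases w) (simp_all add: gh act_def subst_add subst_mult of_int_mod_2 algebra_simps)
  then show ?thesis
    by (simp add: gh mult_V4 act_def subst_subst)
qed

lemma act_one: "act (0, 0) p = p"
proof -
  have "case_var x y z = Var"
    by (auto simp: fun_eq_iff split: var.split)
  then show ?thesis
    by (simp add: act_def)
qed

text \<open>Every element of the Klein four-group is its own inverse. This yields bijectivity of
  each map and surjectivity onto the graded pieces.\<close>

lemma act_involution: "g \<in> carrier V4 \<Longrightarrow> act g (act g p) = p"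
  by (auto simp: act_act carrier_V4 mult_V4 act_one)

lemma bij_act: "g \<in> carrier V4 \<Longrightarrow> bij (act g)"
  using act_involution by (metis bijI' )

lemma act_graded_piece: "p \<in> graded_piece d \<Longrightarrow> act g p \<in> graded_piece d"
  unfolding act_def
proof (rule subst_graded_piece)
  have "of_int n * x \<in> linear_forms" for n
    using graded_piece_mult[OF graded_piece_of_int graded_piece_Var] by fastforce
  then show "(case w of VX \<Rightarrow> x | VY \<Rightarrow> y + of_int (fst g) * x | VZ \<Rightarrow> z + of_int (snd g) * x)
      \<in> linear_forms" for w
    by (cases w) (auto simp del: One_nat_def intro: graded_piece_Var graded_piece_add)
qed

lemma group_action_act: "group_action V4 UNIV act"
proof (intro group_action.intro group_hom.intro group_hom_axioms.intro)
  show "act \<in> hom V4 (BijGroup UNIV)"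
  proof (rule homI)
    show "act g \<in> carrier (BijGroup UNIV)" if "g \<in> carrier V4" for g
      using bij_act[OF that] by (simp add: BijGroup_def Bij_def)
    show "act (g \<otimes>\<^bsub>V4\<^esub> h) = act g \<otimes>\<^bsub>BijGroup UNIV\<^esub> act h"
      if "g \<in> carrier V4" "h \<in> carrier V4" for g h
      using bij_act[OF that(1)] bij_act[OF that(2)]
      by (simp add: BijGroup_def Bij_def compose_def fun_eq_iff act_act)
  qed
qed (simp_all add: group_V4 group_BijGroup)

lemma graded_action_act: "graded_action V4 act"
proof -
  have "act g ` graded_piece d = graded_piece d" if "g \<in> carrier V4" for g d
  proof
    show "act g ` graded_piece d \<subseteq> graded_piece d"
      by (auto intro: act_graded_piece)
    show "graded_piece d \<subseteq> act g ` graded_piece d"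
      using act_involution[OF that] act_graded_piece by (metis image_eqI subsetI)
  qed
  then show ?thesis
    by (simp add: graded_action_def graded_algebra_automorphism_def group_action_act bij_act
      act_add act_mult)
qed

lemma x_neq_0: "x \<noteq> 0"
  using Var_mult_eq_0_iff[of VX 1] by simp

text \<open>The multiples of \<open>x\<close> by which \<open>y\<close> and \<open>z\<close> are
  shifted reveal both coordinates of a group element, because \<open>x\<close> is nonzero.\<close>

lemma faithful_action_act: "faithful_action V4 UNIV act"
proof (intro faithful_action.intro faithful_action_axioms.intro group_action_act inj_onI)
  fix g h assume gh: "g \<in> carrier V4" "h \<in> carrier V4" "act g = act h"
  then have "act g y = act h y" "act g z = act h z"
    by simp_all
  with gh(1,2) show "g = h"
    by (auto simp: carrier_V4 act_y act_z x_neq_0)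
qed


section \<open>The invariant ring\<close>

text \<open>The remaining nontrivial element \<open>(1, 1)\<close> acts as the composite of \<sigma>
  and \<tau>.\<close>

lemma carrier_invariant_ring_V4:
  "carrier (invariant_ring V4 act) = {p. act \<sigma> p = p \<and> act \<tau> p = p}"
proof -
  have "act (1, 1) p = act \<sigma> (act \<tau> p)" for p
    by (simp add: act_act \<sigma>_def \<tau>_def mult_V4)
  then show ?thesis
    by (auto simp: invariant_ring_def carrier_V4 act_one \<sigma>_def \<tau>_def)
qed

lemma subalgebra_invariants: "subalgebra (carrier (invariant_ring V4 act))"
  by (auto simp: subalgebra_def carrier_invariant_ring_V4 act_add act_mult)

lemma generators_invariant: "{x, u, v} \<subseteq> carrier (invariant_ring V4 act)"
  by (auto simp: carrier_invariant_ring_V4 act_add act_mult act_power act_y act_z \<sigma>_def \<tau>_def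
    power2_eq_square algebra_simps)

text \<open>\<open>R\<close> is spanned by \<open>1, y, z, yz\<close> over \<open>k[x, u, v]\<close>, since \<open>y\<^sup>2 = u + xy\<close> and \<open>z\<^sup>2 = v + xz\<close>.\<close>

lemma generated_algebra_module_decomposition:
  fixes p :: "(var, bit) mpoly"
  defines "A \<equiv> generated_algebra {x, u, v}"
  shows "\<exists>a\<in>A. \<exists>b\<in>A. \<exists>c\<in>A. \<exists>d\<in>A. p = a + b * y + c * z + d * (y * z)"
proof -
  \<comment> \<open>\<open>M\<close> is the span of \<open>1\<close>, \<open>y\<close>,
    \<open>z\<close>, \<open>y * z\<close> over \<open>A\<close>. Closure under multiplication by
    \<open>A\<close>, \<open>y\<close> and \<open>z\<close> makes it a subalgebra containing the
    variables.\<close>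
  define M where "M = {p. \<exists>a\<in>A. \<exists>b\<in>A. \<exists>c\<in>A. \<exists>d\<in>A. p = a + b * y + c * z + d * (y * z)}"
  have M: "a + b * y + c * z + d * (y * z) \<in> M" if "a \<in> A" "b \<in> A" "c \<in> A" "d \<in> A" for a b c d
    using that by (auto simp: M_def)
  have alg: "subalgebra A"
    unfolding A_def by (rule subalgebra_generated_algebra)
  note A = subalgebra_Const[OF alg] subalgebra_0[OF alg] subalgebra_add[OF alg] subalgebra_mult[OF alg]
  have gen: "x \<in> A" "u \<in> A" "v \<in> A"
    using generated_algebra_superset[of "{x, u, v}"] by (auto simp: A_def)
  have add: "p + q \<in> M" if pM: "p \<in> M" and qM: "q \<in> M" for p q
  proof -
    obtain a b c d where p: "a \<in> A" "b \<in> A" "c \<in> A" "d \<in> A" "p = a + b * y + c * z + d * (y * z)"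
      using pM unfolding M_def by blast
    obtain a' b' c' d' where q: "a' \<in> A" "b' \<in> A" "c' \<in> A" "d' \<in> A"
        "q = a' + b' * y + c' * z + d' * (y * z)"
      using qM unfolding M_def by blast
    have "p + q = (a + a') + (b + b') * y + (c + c') * z + (d + d') * (y * z)"
      unfolding p q by (simp add: algebra_simps)
    also have "\<dots> \<in> M"
      using p(1-4) q(1-4) by (intro M A)
    finally show ?thesis .
  qed
  have smult: "r * p \<in> M" if rA: "r \<in> A" and pM: "p \<in> M" for r p
  proof -
    obtain a b c d where p: "a \<in> A" "b \<in> A" "c \<in> A" "d \<in> A" "p = a + b * y + c * z + d * (y * z)"
      using pM unfolding M_def by blast
    have "r * p = r * a + (r * b) * y + (r * c) * z + (r * d) * (y * z)"
      unfolding p by (simp add: algebra_simps)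
    also have "\<dots> \<in> M"
      using p(1-4) rA by (intro M A)
    finally show ?thesis .
  qed
  have ymult: "y * p \<in> M" if pM: "p \<in> M" for p
  proof -
    obtain a b c d where p: "a \<in> A" "b \<in> A" "c \<in> A" "d \<in> A" "p = a + b * y + c * z + d * (y * z)"
      using pM unfolding M_def by blast
    \<comment> \<open>Only \<open>b * y\<close> and \<open>d * (y * z)\<close> produce a
      \<open>y^2\<close>, which is replaced by \<open>u + x * y\<close>.\<close>
    have "y * p = b * u + (a + b * x) * y + (d * u) * z + (c + d * x) * (y * z)"
      unfolding p by (simp add: algebra_simps power2_eq_square)
    also have "\<dots> \<in> M"
      using p(1-4) gen by (intro M) (simp_all add: A)
    finally show ?thesis .
  qed
  have zmult: "z * p \<in> M" if pM: "p \<in> M" for p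
  proof -
    obtain a b c d where p: "a \<in> A" "b \<in> A" "c \<in> A" "d \<in> A" "p = a + b * y + c * z + d * (y * z)"
      using pM unfolding M_def by blast
    have "z * p = c * v + (d * v) * y + (a + c * x) * z + (b + d * x) * (y * z)"
      unfolding p by (simp add: algebra_simps power2_eq_square)
    also have "\<dots> \<in> M"
      using p(1-4) gen by (intro M) (simp_all add: A)
    finally show ?thesis .
  qed
  have "p \<in> M"
  proof (induction p rule: mpoly_algebra_induct)
    case (Const c)
    show ?case using M[of "Const c" 0 0 0] A by simp
  next
    case (Var w)
    have "1 \<in> M"
      using M[of 1 0 0 0] A(1)[of 1] A(2) by simp
    then show ?case
      using smult[OF gen(1)] ymult zmult by (cases w) force+
  next
    case (mult p q)
    obtain a b c d where p: "a \<in> A" "b \<in> A" "c \<in> A" "d \<in> A" "p = a + b * y + c * z + d * (y * z)"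
      using mult(1) unfolding M_def by blast
    \<comment> \<open>Only the left factor is expanded, since \<open>M\<close> absorbs
      multiplication by \<open>A\<close>, \<open>y\<close> and \<open>z\<close>.\<close>
    have "p * q = a * q + b * (y * q) + c * (z * q) + d * (y * (z * q))"
      unfolding p by (simp add: algebra_simps)
    also have "\<dots> \<in> M"
      using p(1-4) mult(2) by (intro add smult ymult zmult)
    finally show ?case .
  qed (rule add)
  then show ?thesis
    by (simp add: M_def)
qed

lemma invariant_ring_V4: "carrier (invariant_ring V4 act) = generated_algebra {x, u, v}"
proof
  show "generated_algebra {x, u, v} \<subseteq> carrier (invariant_ring V4 act)"
    using generators_invariant subalgebra_invariants by (rule generated_algebra_minimal)
  then have inv: "act \<sigma> a = a" "act \<tau> a = a" if "a \<in> generated_algebra {x, u, v}" for a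
    using that by (auto simp: carrier_invariant_ring_V4)
  show "carrier (invariant_ring V4 act) \<subseteq> generated_algebra {x, u, v}"
  proof
    fix p assume "p \<in> carrier (invariant_ring V4 act)"
    then have p: "act \<sigma> p = p" "act \<tau> p = p"
      by (simp_all add: carrier_invariant_ring_V4)
    obtain a b c d where A: "a \<in> generated_algebra {x, u, v}" "b \<in> generated_algebra {x, u, v}"
        "c \<in> generated_algebra {x, u, v}" "d \<in> generated_algebra {x, u, v}"
      and eq: "p = a + b * y + c * z + d * (y * z)"
      using generated_algebra_module_decomposition[of p] by blast
    \<comment> \<open>The coefficients are invariant and \<sigma> fixes \<open>z\<close>, so only
      \<open>y\<close> moves, by \<open>x\<close>.\<close>
    have "act \<sigma> p = p + x * (b + d * z)"
      unfolding eq using A by (simp add: act_add act_mult inv act_y act_z \<sigma>_def[symmetric])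
        (simp add: \<sigma>_def algebra_simps)
    then have bd: "b + d * z = 0"
      using p(1) by (simp add: Var_mult_eq_0_iff)
    \<comment> \<open>\<tau> fixes \<open>b\<close> and \<open>d\<close> but sends \<open>z\<close>
      to \<open>z + x\<close>, so the relation just found leaves \<open>x * d = 0\<close>.\<close>
    then have "act \<tau> (b + d * z) = 0"
      by simp
    then have "b + d * z + x * d = 0"
      using A by (simp add: act_add act_mult inv act_z) (simp add: \<tau>_def algebra_simps)
    then have d: "d = 0"
      by (simp add: bd Var_mult_eq_0_iff)
    with bd have b: "b = 0"
      by simp
    have "act \<tau> p = p + x * c"
      unfolding eq b d using A by (simp add: act_add act_mult inv act_z) (simp add: \<tau>_def algebra_simps)
    then have "c = 0"
      using p(2) by (simp add: Var_mult_eq_0_iff)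
    with A(1) show "p \<in> generated_algebra {x, u, v}"
      by (simp add: eq b d)
  qed
qed

section \<open>Algebraic independence of the generators\<close>

lemma power_add_multiple:
  fixes p r t :: "'a::comm_semiring_1"
  shows "\<exists>q. (p + t * r) ^ n = p ^ n + t * q"
proof (induction n)
  case 0
  show ?case by (intro exI[of _ 0]) simp
next
  case (Suc n)
  then obtain q where "(p + t * r) ^ n = p ^ n + t * q" ..
  then have "(p + t * r) ^ Suc n = p ^ Suc n + t * (r * p ^ n + p * q + t * r * q)"
    by (simp add: algebra_simps)
  then show ?case ..
qed

lemma lookup_Var_power_mult:
  assumes "Poly_Mapping.lookup m w < n"
  shows "Poly_Mapping.lookup (Var w ^ n * q) m = 0"
proof (rule ccontr)
  assume "Poly_Mapping.lookup (Var w ^ n * q) m \<noteq> 0"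
  then have "m \<in> Poly_Mapping.keys (Var w ^ n * q)"
    by (simp add: in_keys_iff)
  then obtain m' where "m = Poly_Mapping.single w n + m'"
    using keys_mult[of "Var w ^ n" q] by (auto simp: Var_power)
  with assms show False
    by (simp add: lookup_add)
qed

text \<open>Modulo \<open>x^(i+1)\<close> the product equals \<open>x^i * y^(2*j) * z^(2*k)\<close>,
  and coefficients at monomials with \<open>x\<close>-exponent at most \<open>i\<close> see only
  this residue.\<close>

lemma lookup_generator_monomial:
  assumes "Poly_Mapping.lookup m VX \<le> i"
  shows "Poly_Mapping.lookup (x ^ i * u ^ j * v ^ k) m =
    (if Poly_Mapping.lookup m VX = i \<and> Poly_Mapping.lookup m VY = 2 * j \<and> Poly_Mapping.lookup m VZ = 2 * k
     then 1 else 0)"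
proof -
  define e where "e = Poly_Mapping.single VX i + Poly_Mapping.single VY (2 * j) + Poly_Mapping.single VZ (2 * k)"
  obtain q r where "u ^ j = (y\<^sup>2) ^ j + x * q" "v ^ k = (z\<^sup>2) ^ k + x * r"
    using power_add_multiple by metis
  then have "x ^ i * u ^ j * v ^ k =
      x ^ i * y ^ (2 * j) * z ^ (2 * k) + x ^ Suc i * (y ^ (2 * j) * r + q * z ^ (2 * k) + x * q * r)"
    unfolding power_mult by (simp add: algebra_simps)
  also have "x ^ i * y ^ (2 * j) * z ^ (2 * k) = Poly_Mapping.single e 1"
    by (simp add: Var_power mult_single e_def)
  finally have "Poly_Mapping.lookup (x ^ i * u ^ j * v ^ k) m = (1 when e = m)"
    using assms by (simp only: lookup_add lookup_single)
      (simp add: lookup_Var_power_mult del: power_Suc)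
  moreover have "e = m \<longleftrightarrow> Poly_Mapping.lookup m VX = i \<and> Poly_Mapping.lookup m VY = 2 * j \<and>
      Poly_Mapping.lookup m VZ = 2 * k"
  proof
    assume R: "Poly_Mapping.lookup m VX = i \<and> Poly_Mapping.lookup m VY = 2 * j \<and> Poly_Mapping.lookup m VZ = 2 * k"
    show "e = m"
    proof (rule poly_mapping_eqI)
      show "Poly_Mapping.lookup e w = Poly_Mapping.lookup m w" for w
        using R by (cases w) (simp_all add: e_def lookup_add lookup_single)
    qed
  qed (auto simp: e_def lookup_add lookup_single)
  ultimately show ?thesis
    by simp
qed

text \<open>The generators index the variables of a relation; distinctness lets a product over
  \<open>{x, u, v}\<close> split into three separate powers. Evaluation at \<open>(1, 0, 0)\<close>
  and \<open>(0, 1, 0)\<close> separates them.\<close>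

lemma generators_distinct: "x \<noteq> u" "x \<noteq> v" "u \<noteq> v"
proof -
  let ?e = "subst (case_var 1 0 0) :: (var, bit) mpoly \<Rightarrow> (var, bit) mpoly"
  have "?e x = 1" "?e u = 0" "?e v = 0"
    by (simp_all add: subst_add subst_mult power2_eq_square)
  then show "x \<noteq> u" "x \<noteq> v"
    by (metis zero_neq_one)+
  let ?f = "subst (case_var 0 1 0) :: (var, bit) mpoly \<Rightarrow> (var, bit) mpoly"
  have "?f u = 1" "?f v = 0"
    by (simp_all add: subst_add subst_mult power2_eq_square)
  then show "u \<noteq> v"
    by (metis zero_neq_one)
qed

lemma algebraically_independent_generators: "algebraically_independent {x, u, v}"
  unfolding algebraically_independent_def
proof (intro allI impI, elim conjE, rule ccontr)
  fix p :: "((var, bit) mpoly, bit) mpoly"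
  assume keys: "\<forall>m\<in>Poly_Mapping.keys p. Poly_Mapping.keys m \<subseteq> {x, u, v}"
    and rel: "subst (\<lambda>s. s) p = 0" and "p \<noteq> 0"
  then have "Poly_Mapping.keys p \<noteq> {}"
    by simp
  \<comment> \<open>A monomial with least exponent at the generator \<open>x\<close> is taken, so
    that every term of the relation meets the bound in
    \<open>lookup_generator_monomial\<close>.\<close>
  then obtain m where m: "m \<in> Poly_Mapping.keys p"
      "\<And>n. n \<in> Poly_Mapping.keys p \<Longrightarrow> Poly_Mapping.lookup m x \<le> Poly_Mapping.lookup n x"
    using ex_min_if_finite[of "(\<lambda>n. Poly_Mapping.lookup n x) ` Poly_Mapping.keys p"]
    by (auto simp: not_less)
  \<comment> \<open>\<open>e\<close> is the lowest-order term in \<open>x\<close> of the image of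
    \<open>m\<close>; no other monomial of \<open>p\<close> contributes to its coefficient.\<close>
  define e where "e = Poly_Mapping.single VX (Poly_Mapping.lookup m x) +
    Poly_Mapping.single VY (2 * Poly_Mapping.lookup m u) + Poly_Mapping.single VZ (2 * Poly_Mapping.lookup m v)"
  have "Poly_Mapping.lookup (\<Prod>s\<in>Poly_Mapping.keys n. s ^ Poly_Mapping.lookup n s) e = (if n = m then 1 else 0)"
    if n: "n \<in> Poly_Mapping.keys p" for n
  proof -
    have "(\<Prod>s\<in>Poly_Mapping.keys n. s ^ Poly_Mapping.lookup n s) =
        x ^ Poly_Mapping.lookup n x * u ^ Poly_Mapping.lookup n u * v ^ Poly_Mapping.lookup n v"
      using keys n generators_distinct by (subst prod_keys_superset[of "{x, u, v}"]) (simp_all add: mult.assoc)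
    \<comment> \<open>Both exponent functions vanish outside \<open>{x, u, v}\<close>, so three
      exponents determine the monomial.\<close>
    moreover have "n = m" if eq: "Poly_Mapping.lookup n x = Poly_Mapping.lookup m x"
        "Poly_Mapping.lookup n u = Poly_Mapping.lookup m u" "Poly_Mapping.lookup n v = Poly_Mapping.lookup m v"
    proof (rule poly_mapping_eqI)
      fix s
      show "Poly_Mapping.lookup n s = Poly_Mapping.lookup m s"
      proof (cases "s \<in> {x, u, v}")
        case False
        then have "s \<notin> Poly_Mapping.keys n" "s \<notin> Poly_Mapping.keys m"
          using keys n m(1) by blast+
        then show ?thesis by (simp add: in_keys_iff)
      qed (use eq in auto)
    qed
    ultimately show ?thesis
      using m(2)[OF n] by (subst \<open>_ = x ^ _ * _ * _\<close>, subst lookup_generator_monomial)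
        (auto simp: e_def lookup_add lookup_single)
  qed
  then have "Poly_Mapping.lookup (subst (\<lambda>s. s) p) e =
      (\<Sum>n\<in>Poly_Mapping.keys p. if n = m then Poly_Mapping.lookup p m else 0)"
    unfolding subst_def lookup_sum by (intro sum.cong) (auto simp: lookup_Const_mult)
  also have "\<dots> = Poly_Mapping.lookup p m"
    using m(1) by simp
  finally show False
    using m(1) rel by (simp add: in_keys_iff)
qed


section \<open>Full norms of linear forms\<close>

text \<open>Over the field with two elements each conjugate is \<open>l\<close> or
  \<open>l + x\<close>. If \<open>l\<close> is moved, each occurs twice; if it is fixed,
  \<open>l\<close> occurs four times.\<close>

lemma full_norm_eq_square:
  assumes "l \<in> linear_forms"
  obtains f where "f \<in> carrier (invariant_ring V4 act)" "f \<in> graded_piece 2" "full_norm V4 act l = f * f"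
proof -
  have UNIV: "(UNIV :: var set) = {VX, VY, VZ}"
    using var.exhaust by blast
  obtain a b c where l: "l = Const a * x + Const b * y + Const c * z"
    using linear_form_expansion[OF assms] unfolding UNIV by (auto simp: add.assoc)
  have s: "act \<sigma> l = l + Const b * x" and t: "act \<tau> l = l + Const c * x"
    and st: "act (1, 1) l = l + Const b * x + Const c * x"
    by (simp_all add: l act_add act_mult act_y act_z \<sigma>_def \<tau>_def algebra_simps)
  have "full_norm V4 act l = l * (l + Const c * x) * (l + Const b * x) * (l + Const b * x + Const c * x)"
    using s t st by (simp add: full_norm_def carrier_V4 act_one \<sigma>_def \<tau>_def mult.assoc)
  \<comment> \<open>\<open>r\<close> is the shift to the other point of the orbit, or
    \<open>0\<close> when \<open>l\<close> is fixed; in both cases \<open>l * (l + r)\<close> is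
    invariant and squares to the norm.\<close>
  moreover define r where "r = (if b = 0 \<and> c = 0 then 0 else x)"
  ultimately have "full_norm V4 act l = (l * (l + r)) * (l * (l + r))"
    by (cases b; cases c) (simp_all add: mult_ac add.assoc)
  moreover have "l * (l + r) \<in> carrier (invariant_ring V4 act)"
    by (cases b; cases c) (simp_all add: carrier_invariant_ring_V4 act_add act_mult s t r_def mult_ac add.assoc)
  moreover have "l + r \<in> linear_forms"
    using assms by (auto simp: r_def simp del: One_nat_def intro: graded_piece_add graded_piece_Var)
  then have "l * (l + r) \<in> graded_piece 2"
    using graded_piece_mult[OF assms, of "l + r" 1] by (simp add: numeral_2_eq_2)
  ultimately show thesis
    using that by blast
qed

lemma full_norm_in_invariant_ideal_square:
  assumes "l \<in> linear_forms"
  shows "full_norm V4 act l \<in> invariant_ideal_square V4 act"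
proof -
  obtain f where f: "f \<in> carrier (invariant_ring V4 act)" "f \<in> graded_piece 2"
      and norm: "full_norm V4 act l = f * f"
    using assms by (rule full_norm_eq_square)
  \<comment> \<open>Homogeneity of degree 2 excludes a constant term, so the square root
    \<open>f\<close> of the norm lies in the positive ideal.\<close>
  have "Poly_Mapping.lookup f 0 = 0"
    using f(2) by (force simp: graded_piece_def in_keys_iff)
  with f(1) have "f \<in> invariant_ideal V4 act"
    by (simp add: invariant_ideal_def)
  then have "f \<otimes>\<^bsub>invariant_ring V4 act\<^esub> f \<in> invariant_ideal_square V4 act"
    unfolding invariant_ideal_square_def by (intro ideal_prod.prod)
  then show ?thesis
    by (simp add: norm invariant_ring_def ring_of_type_algebra_def)
qed

lemma full_norm_notin_minimal_generating_set:
  assumes "homogeneous_minimal_generating_set (carrier (invariant_ring V4 act)) S" and "l \<in> linear_forms"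
  shows "full_norm V4 act l \<notin> S"
proof -
  obtain f where "f \<in> carrier (invariant_ring V4 act)" "f \<in> graded_piece 2" "full_norm V4 act l = f * f"
    using assms(2) by (rule full_norm_eq_square)
  then show ?thesis
    using product_notin_homogeneous_minimal_generating_set[OF assms(1), of f 2 f 2] by simp
qed

section \<open>Polynomiality, modularity and the refutation\<close>

lemma polynomial_algebra_invariants: "polynomial_algebra (carrier (invariant_ring V4 act))"
  unfolding polynomial_algebra_def
  using algebraically_independent_generators invariant_ring_V4 by blast

text \<open>The group order is 4, which vanishes in characteristic two: the representation is
  modular.\<close>

lemma CHAR_bit_dvd_order_V4: "CHAR(bit) dvd Coset.order V4"
proof -
  have "Coset.order V4 = 2 * 2"
    by (simp add: Coset.order_def carrier_V4)
  moreover have "of_nat (2 * 2) = (0 :: bit)"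
    by (simp only: of_nat_mult of_nat_numeral bit_2_eq_0 mult_zero_left)
  ultimately show ?thesis
    by (simp only: of_nat_eq_0_iff_char_dvd)
qed

text \<open>The action satisfies every hypothesis, while
  \<open>full_norm_notin_minimal_generating_set\<close> denies the existential conclusion for every
  linear form, \<open>0\<close> included.\<close>

lemma not_wehlau_conjecture_full_norm:
  "\<not> wehlau_conjecture_full_norm TYPE(bit) TYPE(var) TYPE(int \<times> int)"
proof
  assume "wehlau_conjecture_full_norm TYPE(bit) TYPE(var) TYPE(int \<times> int)"
  moreover have "finite (carrier V4)"
    by (simp add: carrier_V4)
  ultimately show False
    using graded_action_act faithful_action_act CHAR_bit_dvd_order_V4 polynomial_algebra_invariants
      full_norm_notin_minimal_generating_set
    unfolding wehlau_conjecture_full_norm_def by blast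
qed

theorem theorem1p3:
  shows "generate V4 {\<sigma>, \<tau>} = carrier V4 \<and>
    graded_action V4 act \<and>
    faithful_action V4 UNIV act \<and>
    act \<sigma> x = x \<and>
    act \<sigma> y = y + x \<and>
    act \<sigma> z = z \<and>
    act \<tau> x = x \<and>
    act \<tau> y = y \<and>
    act \<tau> z = z + x \<and>
    carrier (invariant_ring V4 act) = generated_algebra {x, y\<^sup>2 + x * y, z\<^sup>2 + x * z} \<and>
    algebraically_independent {x, y\<^sup>2 + x * y, z\<^sup>2 + x * z} \<and>
    polynomial_algebra (carrier (invariant_ring V4 act)) \<and>
    (\<forall>l\<in>linear_forms. l \<noteq> 0 \<longrightarrow> full_norm V4 act l \<in> invariant_ideal_square V4 act) \<and>
    (\<forall>S. homogeneous_minimal_generating_set (carrier (invariant_ring V4 act)) S \<longrightarrow>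
           (\<forall>l\<in>linear_forms. full_norm V4 act l \<notin> S)) \<and>
    \<not> wehlau_conjecture_full_norm TYPE(bit) TYPE(var) TYPE(int \<times> int)"
  by (intro conjI ballI allI impI generate_V4 graded_action_act faithful_action_act act_x
      invariant_ring_V4 algebraically_independent_generators polynomial_algebra_invariants
      full_norm_in_invariant_ideal_square full_norm_notin_minimal_generating_set
      not_wehlau_conjecture_full_norm)
    (simp_all add: act_y act_z \<sigma>_def \<tau>_def)

end
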